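(* Let $k\in\mathbb{N}$, $k\ge 2$. Let $\mathcal{T}$ be a positive linear functional defined on a linear subspace of $\mathbb{R}^{[-1,1]}$ that contains $\mathcal{C}^k([-1,1])$ and all $(k-1)$-convex functions $[-1,1]\to\mathbb{R}$. If $\mathcal{T}$ is exact on $\Pi_k$, then $$\bigl|\mathcal{I}(f)-\mathcal{T}(f)\bigr|\le\alpha_k\|f^{(k)}\|_\infty$$ for any $f\in\mathcal{C}^k([-1,1])$.
   Context: The constants are defined, for integers $n\ge 1$, by $$\alpha_{2n}:=\frac{4^{n+1}(n!)^4}{(2n+1)[(2n)!]^3},\qquad \alpha_{2n+1}:=\frac{4^{n+1}(n+1)(n!)^4}{[(2n+1)!]^3}.$$ Divided differences: $[x_1;f]:=f(x_1)$ and $[x_1,\dots,x_{j+1};f]:=\frac{[x_2,\dots,x_{j+1};f]-[x_1,\dots,x_j;f]}{x_{j+1}-x_1}$ for $j\ge 1$. For an integer $m\ge 1$, a function $f:[-1,1]\to\mathbb{R}$ is $m$-convex if $[x_1,\dots,x_{m+2};f]\ge 0$ for all distinct $x_1,\dots,x_{m+2}\in[-1,1]$. $\Pi_m$ is the space of real polynomials of degree at most $m$. $\mathcal{I}(f):=\int_{-1}^1 f(x)\,dx$. A real-valued linear functional $\mathcal{T}$ on a linear space $X$ of real functions is positive if $f\le g$ (pointwise) implies $\mathcal{T}(f)\le\mathcal{T}(g)$ for all $f,g\in X$. $\mathcal{T}$ is exact on $\Pi_m$ if $\mathcal{T}(p)=\mathcal{I}(p)$ for all $p\in\Pi_m$.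 $\|g\|_\infty:=\sup\{|g(x)|: x\in[-1,1]\}$ for continuous $g$ on $[-1,1]$. *)

theory Defs
  imports "HOL-Analysis.Analysis" "HOL-Computational_Algebra.Polynomial"
begin

(* A function [-1,1] -> R is represented by any total function real => real extending it.
   Regularity, convexity, norm and positivity below look only at the values on {-1..1}. *)

definition alpha :: "nat \<Rightarrow> real" where
  "alpha k = (let n = k div 2 in
     if even k then 4 ^ (n + 1) * fact n ^ 4 / ((2 * real n + 1) * fact (2 * n) ^ 3)
     else 4 ^ (n + 1) * (real n + 1) * fact n ^ 4 / fact (2 * n + 1) ^ 3)"

fun divided_difference :: "(real \<Rightarrow> real) \<Rightarrow> real list \<Rightarrow> real" where
  "divided_difference f [] = 0"
| "divided_difference f [x] = f x"
| "divided_difference f (x # y # xs) =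
     (divided_difference f (y # xs) - divided_difference f (butlast (x # y # xs)))
       / (last (y # xs) - x)"

definition m_convex :: "nat \<Rightarrow> (real \<Rightarrow> real) \<Rightarrow> bool" where
  "m_convex m f \<longleftrightarrow> (\<forall>xs. length xs = m + 2 \<and> distinct xs \<and> set xs \<subseteq> {-1..1}
     \<longrightarrow> 0 \<le> divided_difference f xs)"

(* Derivatives are taken relative to [-1,1], hence one-sided at the endpoints. *)
definition nth_derivative :: "nat \<Rightarrow> (real \<Rightarrow> real) \<Rightarrow> real \<Rightarrow> real" where
  "nth_derivative k = (\<lambda>g x. vector_derivative g (at x within {-1..1})) ^^ k"

definition C_k :: "nat \<Rightarrow> (real \<Rightarrow> real) set" where
  "C_k k = {f. (\<forall>j<k. nth_derivative j f differentiable_on {-1..1}) \<and>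
               continuous_on {-1..1} (nth_derivative k f)}"

definition sup_norm :: "(real \<Rightarrow> real) \<Rightarrow> real" where
  "sup_norm g = (SUP x\<in>{-1..1}. \<bar>g x\<bar>)"

definition function_subspace :: "(real \<Rightarrow> real) set \<Rightarrow> bool" where
  "function_subspace X \<longleftrightarrow> (\<lambda>x. 0) \<in> X \<and>
     (\<forall>f\<in>X. \<forall>g\<in>X. (\<lambda>x. f x + g x) \<in> X) \<and> (\<forall>c. \<forall>f\<in>X. (\<lambda>x. c * f x) \<in> X)"

definition linear_functional_on ::
    "(real \<Rightarrow> real) set \<Rightarrow> ((real \<Rightarrow> real) \<Rightarrow> real) \<Rightarrow> bool" where
  "linear_functional_on X T \<longleftrightarrow>
     (\<forall>f\<in>X. \<forall>g\<in>X. T (\<lambda>x. f x + g x) = T f + T g) \<and>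
     (\<forall>c. \<forall>f\<in>X. T (\<lambda>x. c * f x) = c * T f)"

(* In particular T takes equal values on members of X that agree on [-1,1], so on X it is
   really a functional of the restrictions to [-1,1]. *)
definition positive_functional_on ::
    "(real \<Rightarrow> real) set \<Rightarrow> ((real \<Rightarrow> real) \<Rightarrow> real) \<Rightarrow> bool" where
  "positive_functional_on X T \<longleftrightarrow>
     (\<forall>f\<in>X. \<forall>g\<in>X. (\<forall>x\<in>{-1..1}. f x \<le> g x) \<longrightarrow> T f \<le> T g)"

definition exact_on_polys :: "nat \<Rightarrow> ((real \<Rightarrow> real) \<Rightarrow> real) \<Rightarrow> bool" where
  "exact_on_polys m T \<longleftrightarrow>
     (\<forall>p :: real poly. degree p \<le> m \<longrightarrow> T (poly p) = integral {-1..1} (poly p))"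

end

theory Submission
  imports Defs
begin

text \<open>
Write \<open>k = 2 n + e\<close> with \<open>e \<in> {0, 1}\<close> and let \<open>W(x) = (x + 1)\<^sup>e \<omega>(x)\<^sup>2\<close>, where \<open>\<omega>\<close> is a monic polynomial
with \<open>n\<close> distinct zeros in \<open>(-1, 1)\<close>. Let \<open>p\<close> be the polynomial of degree less than \<open>k\<close> that
interpolates \<open>f\<close> at these zeros together with its derivative, and at \<open>-1\<close> if \<open>e = 1\<close>. By Rolle's
theorem the interpolation error satisfies \<open>|f - p| \<le> M / k! * W\<close> on \<open>[-1, 1]\<close>, where \<open>M\<close> is the
supremum norm of the \<open>k\<close>-th derivative (\<open>hermite_error\<close>); the point is that \<open>W\<close> is nonnegative
there and monic of degree exactly \<open>k\<close>.

Hence \<open>f\<close> lies between the two polynomials \<open>p - M / k! * W\<close> and \<open>p + M / k! * W\<close> of degree at most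
\<open>k\<close>. Both the integral and \<open>T\<close> are monotone, and they take the same values on these two polynomials.
So both numbers lie in one interval of length \<open>2 M / k!\<close> times the integral of \<open>W\<close>, which bounds
their distance.

It remains to choose \<open>\<omega>\<close> so that the integral of \<open>W\<close> has the right value. The minimizing choice is
the monic orthogonal polynomial of degree \<open>n\<close> for the weight \<open>(x + 1)\<^sup>e\<close>. Rodrigues' formula defines
it as \<open>(x + 1)\<^sup>e \<omega> = const * D\<^sup>n ((x - 1)\<^sup>n (x + 1)\<^sup>n\<^sup>+\<^sup>e)\<close>. Repeated use of Rolle's theorem shows that
this derivative has \<open>n\<close> zeros in \<open>(-1, 1)\<close> (\<open>jacobi_factorization\<close>), and \<open>n\<close> integrations by parts
reduce the integral of \<open>W\<close> to a Beta integral (\<open>integral_hermite_weight_jacobi\<close>). Twice the result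
divided by \<open>k!\<close> is \<open>alpha k\<close> (\<open>alpha_eq\<close>).
\<close>

section \<open>Rolle's theorem for finitely many zeros\<close>

text \<open>Successive derivatives relative to the closed interval are carried along as a whole family. This
lets the iterated derivatives of a \<open>C_k\<close> function, those of a polynomial and their
difference all pass through one Rolle argument.\<close>

definition derivative_chain :: "real \<Rightarrow> real \<Rightarrow> nat \<Rightarrow> (nat \<Rightarrow> real \<Rightarrow> real) \<Rightarrow> bool" where
  "derivative_chain a b m D \<longleftrightarrow>
     (\<forall>j<m. \<forall>x\<in>{a..b}. (D j has_real_derivative D (Suc j) x) (at x within {a..b}))"

lemma derivative_chainD:
  "derivative_chain a b m D \<Longrightarrow> j < m \<Longrightarrow> x \<in> {a..b} \<Longrightarrow>
     (D j has_real_derivative D (Suc j) x) (at x within {a..b})"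
  by (simp add: derivative_chain_def)

lemma derivative_chain_shift:
  "derivative_chain a b (Suc m) D \<Longrightarrow> derivative_chain a b m (\<lambda>j. D (Suc j))"
  by (simp add: derivative_chain_def)

lemma derivative_chain_diff:
  "derivative_chain a b m D \<Longrightarrow> derivative_chain a b m E \<Longrightarrow>
     derivative_chain a b m (\<lambda>j x. D j x - E j x)"
  by (auto simp: derivative_chain_def intro!: derivative_eq_intros)

lemma derivative_chain_poly:
  "derivative_chain a b m (\<lambda>j. poly ((pderiv ^^ j) p))"
  by (auto simp: derivative_chain_def intro: has_field_derivative_at_within[OF poly_DERIV])

lemma Rolle_closed_interval:
  fixes f f' :: "real \<Rightarrow> real"
  assumes der: "\<And>x. x \<in> {a..b} \<Longrightarrow> (f has_real_derivative f' x) (at x within {a..b})"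
    and "a \<le> u" "u < v" "v \<le> b" and "f u = f v"
  obtains z where "u < z" "z < v" "f' z = 0"
proof -
  have "continuous_on {a..b} f"
    using der by (rule DERIV_continuous_on)
  then have cont: "continuous_on {u..v} f"
    by (rule continuous_on_subset) (use assms in auto)
  have der_at: "(f has_derivative (\<lambda>h. f' x * h)) (at x)" if "u < x" "x < v" for x
  proof -
    have "at x within {a..b} = at x"
      using that assms by (intro at_within_interior) auto
    then show ?thesis
      using der[of x] that assms by (simp add: has_field_derivative_def)
  qed
  obtain z where "u < z" "z < v" and "(\<lambda>h. f' z * h) = (\<lambda>h. 0)"
    using Rolle_deriv[OF \<open>u < v\<close> \<open>f u = f v\<close> cont der_at] by blast
  then show thesis
    using that by (metis mult_1_right)
qed

text \<open>Between any two neighbouring zeros lies a zero of the derivative. Adding the points of \<open>Z\<close> in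
increasing order makes this an induction: the zero gained with a new largest point lies to the
right of all earlier ones. The bound by \<open>Max Z\<close> is there to record exactly that.\<close>

lemma Rolle_finite_Max:
  fixes f f' :: "real \<Rightarrow> real"
  assumes der: "\<And>x. x \<in> {a..b} \<Longrightarrow> (f has_real_derivative f' x) (at x within {a..b})"
    and "finite Z" "Z \<noteq> {}" "Z \<subseteq> {a..b}" and zero: "\<And>z. z \<in> Z \<Longrightarrow> f z = 0"
  shows "\<exists>Y. finite Y \<and> Suc (card Y) = card Z \<and> Y \<inter> Z = {} \<and> Y \<subseteq> {a<..<Max Z} \<and>
           (\<forall>y\<in>Y. f' y = 0)"
  using assms(2-)
proof (induction Z rule: finite_linorder_max_induct)
  case empty
  then show ?case by simp
next
  case (insert v Z)
  show ?case
  proof (cases "Z = {}")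
    case True
    then show ?thesis by (intro exI[of _ "{}"]) auto
  next
    case False
    let ?u = "Max Z"
    have u: "?u \<in> Z" "?u < v" and le: "\<And>z. z \<in> Z \<Longrightarrow> z \<le> ?u"
      using insert False by auto
    obtain Y where Y: "finite Y" "Suc (card Y) = card Z" "Y \<inter> Z = {}" "Y \<subseteq> {a<..<?u}"
        "\<forall>y\<in>Y. f' y = 0"
      using insert False by auto
    have "a \<le> ?u" using u insert.prems by auto
    obtain y where y: "?u < y" "y < v" "f' y = 0"
      using Rolle_closed_interval[OF der \<open>a \<le> ?u\<close> u(2)] u insert.prems by auto
    have max: "Max (insert v Z) = v"
      using insert.hyps False u by simp
    have "y \<notin> Y" "y \<notin> Z" "v \<notin> Y" "v \<notin> Z"
      using Y y u le by force+
    then show ?thesis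
      unfolding max using Y y u insert.hyps \<open>a \<le> ?u\<close>
      by (intro exI[of _ "insert y Y"]) force
  qed
qed

text \<open>Disjointness from \<open>Z\<close> is part of the conclusion because a double zero of \<open>f\<close> in \<open>Z\<close> supplies
one more zero of \<open>f'\<close>, which may then be counted in addition to the points of \<open>Y\<close>.\<close>

lemma Rolle_finite:
  fixes f f' :: "real \<Rightarrow> real"
  assumes der: "\<And>x. x \<in> {a..b} \<Longrightarrow> (f has_real_derivative f' x) (at x within {a..b})"
    and Z: "finite Z" "Z \<noteq> {}" "Z \<subseteq> {a..b}" and zero: "\<And>z. z \<in> Z \<Longrightarrow> f z = 0"
  obtains Y where "finite Y" "Suc (card Y) = card Z" "Y \<inter> Z = {}" "Y \<subseteq> {a<..<b}"
    "\<forall>y\<in>Y. f' y = 0"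
proof -
  have "Max Z \<le> b" using Z by (meson Max_in atLeastAtMost_iff subsetD)
  then have "{a<..<Max Z} \<subseteq> {a<..<b}" by auto
  then show thesis
    using Rolle_finite_Max[OF der Z zero] that by (metis subset_trans)
qed

lemma Rolle_iterated:
  assumes "derivative_chain a b m D" and "finite Z" "card Z = Suc m" "Z \<subseteq> {a..b}"
    and "\<And>z. z \<in> Z \<Longrightarrow> D 0 z = 0"
  shows "\<exists>z\<in>{a..b}. D m z = 0"
  using assms
proof (induction m arbitrary: D Z)
  case 0
  then show ?case by (metis card_1_singletonE insertI1 subsetD One_nat_def)
next
  case (Suc m)
  have "Z \<noteq> {}" using Suc.prems by auto
  moreover have "(D 0 has_real_derivative D (Suc 0) x) (at x within {a..b})" if "x \<in> {a..b}" for x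
    using derivative_chainD[OF Suc.prems(1)] that by auto
  ultimately obtain Y where Y: "finite Y" "Suc (card Y) = card Z" "Y \<subseteq> {a<..<b}"
      "\<forall>y\<in>Y. D (Suc 0) y = 0"
    using Rolle_finite[of a b "D 0" "D (Suc 0)" Z] Suc.prems by metis
  then have "Y \<subseteq> {a..b}" by auto
  then show ?case
    using Suc.IH[of "\<lambda>j. D (Suc j)" Y] derivative_chain_shift[OF Suc.prems(1)] Y Suc.prems
    by auto
qed

section \<open>Hermite interpolation with simple and double nodes\<close>

definition node_poly :: "real set \<Rightarrow> real poly" where
  "node_poly A = (\<Prod>a\<in>A. [:-a, 1:])"

lemma degree_node_poly [simp]: "degree (node_poly A) = card A"
  unfolding node_poly_def by (subst degree_prod_sum_eq) auto

lemma lead_coeff_node_poly: "lead_coeff (node_poly A) = 1"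
  unfolding node_poly_def by (simp add: lead_coeff_prod)

lemma node_poly_neq_0 [simp]: "node_poly A \<noteq> 0"
  using lead_coeff_node_poly[of A] by auto

lemma poly_node_poly_eq_0_iff: "finite A \<Longrightarrow> poly (node_poly A) x = 0 \<longleftrightarrow> x \<in> A"
  unfolding node_poly_def by (auto simp: poly_prod)

text \<open>The nodal polynomial of an interpolation problem that prescribes values on \<open>S \<union> R\<close> and also first
derivatives on \<open>R\<close>.\<close>

definition hermite_weight :: "real set \<Rightarrow> real set \<Rightarrow> real poly" where
  "hermite_weight S R = node_poly S * (node_poly R)\<^sup>2"

lemma degree_hermite_weight: "degree (hermite_weight S R) = card S + 2 * card R"
  by (simp add: hermite_weight_def degree_mult_eq degree_power_eq)

lemma lead_coeff_hermite_weight: "lead_coeff (hermite_weight S R) = 1"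
  by (simp only: hermite_weight_def lead_coeff_mult lead_coeff_power lead_coeff_node_poly) simp

lemma poly_hermite_weight_eq_0_iff:
  "finite S \<Longrightarrow> finite R \<Longrightarrow> poly (hermite_weight S R) x = 0 \<longleftrightarrow> x \<in> S \<union> R"
  by (auto simp: hermite_weight_def poly_node_poly_eq_0_iff)

lemma pderiv_hermite_weight_double_node:
  assumes "finite R" "x \<in> R"
  shows "poly (pderiv (hermite_weight S R)) x = 0"
proof -
  have "poly (node_poly R) x = 0"
    using assms by (simp add: poly_node_poly_eq_0_iff)
  then show ?thesis
    by (simp add: hermite_weight_def pderiv_mult power2_eq_square)
qed

text \<open>Newton's scheme: a multiple of the nodal polynomial of the old nodes corrects the value at the new
node without disturbing the others. The degree bound is phrased through vanishing coefficients,
since with no nodes the interpolant is \<open>0\<close> and \<open>degree p < 0\<close> would be unsatisfiable.\<close>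

lemma simple_interpolation:
  fixes S :: "real set"
  assumes "finite S"
  shows "\<exists>p. (\<forall>i\<ge>card S. coeff p i = 0) \<and> (\<forall>s\<in>S. poly p s = g s)"
  using assms
proof (induction S)
  case empty
  then show ?case by (intro exI[of _ 0]) auto
next
  case (insert s S)
  then obtain p where p: "\<forall>i\<ge>card S. coeff p i = 0" "\<forall>s\<in>S. poly p s = g s" by blast
  let ?W = "node_poly S"
  define c where "c = (g s - poly p s) / poly ?W s"
  have W: "poly ?W s \<noteq> 0" using insert by (simp add: poly_node_poly_eq_0_iff)
  have "coeff (p + smult c ?W) i = 0" if "i \<ge> card (insert s S)" for i
    using that p insert.hyps by (auto simp: coeff_eq_0)
  moreover have "poly (p + smult c ?W) x = g x" if "x \<in> insert s S" for x
    using that p W insert.hyps by (auto simp: c_def poly_node_poly_eq_0_iff)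
  ultimately show ?case by blast
qed

text \<open>Newton's scheme with double nodes: at a new node \<open>r\<close> the two free parameters of the correction
\<open>(c + d (x - r)) W(x)\<close> are used to match first the value and then the derivative, while the old
nodes keep their data because \<open>W\<close> vanishes on \<open>S \<union> R\<close> and \<open>W'\<close> vanishes on \<open>R\<close>.\<close>

lemma hermite_interpolation:
  fixes S R :: "real set"
  assumes "finite R" "finite S" "S \<inter> R = {}"
  shows "\<exists>p. (\<forall>i\<ge>card S + 2 * card R. coeff p i = 0) \<and> (\<forall>x\<in>S \<union> R. poly p x = g x) \<and>
           (\<forall>x\<in>R. poly (pderiv p) x = g' x)"
  using assms
proof (induction R)
  case empty
  then show ?case using simple_interpolation[of S g] by auto
next
  case (insert r R)
  then obtain p where p: "\<forall>i\<ge>card S + 2 * card R. coeff p i = 0"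
      "\<forall>x\<in>S \<union> R. poly p x = g x" "\<forall>x\<in>R. poly (pderiv p) x = g' x"
    by auto
  let ?W = "hermite_weight S R"
  have W: "poly ?W r \<noteq> 0"
    using insert by (auto simp: poly_hermite_weight_eq_0_iff)
  define c where "c = (g r - poly p r) / poly ?W r"
  define d where "d = (g' r - poly (pderiv p) r - c * poly (pderiv ?W) r) / poly ?W r"
  \<comment> \<open>This is \<open>c + d (x - r)\<close>.\<close>
  let ?q = "[:c - d * r, d:]"
  let ?p = "p + ?q * ?W"
  have pderiv_p: "poly (pderiv ?p) x = poly (pderiv p) x +
      (c + d * (x - r)) * poly (pderiv ?W) x + d * poly ?W x" for x
    by (simp add: pderiv_add pderiv_mult pderiv_pCons pderiv_smult algebra_simps)
  have "coeff ?p i = 0" if "i \<ge> card S + 2 * card (insert r R)" for i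
  proof -
    have "degree (?q * ?W) \<le> 1 + (card S + 2 * card R)"
      using degree_mult_le[of ?q ?W] degree_pCons_le[of "c - d * r" "[:d:]"]
      by (simp add: degree_hermite_weight)
    then have "coeff (?q * ?W) i = 0"
      using that insert.hyps by (intro coeff_eq_0) auto
    then show ?thesis using p that insert.hyps by simp
  qed
  moreover have "poly ?p x = g x" if "x \<in> S \<union> insert r R" for x
  proof (cases "x = r")
    case True
    have "c * poly ?W r = g r - poly p r" using W by (simp add: c_def)
    then show ?thesis by (simp add: True algebra_simps)
  next
    case False
    then have "poly ?W x = 0"
      using that insert by (auto simp: poly_hermite_weight_eq_0_iff)
    then show ?thesis using that False p by auto
  qed
  moreover have "poly (pderiv ?p) x = g' x" if "x \<in> insert r R" for x
  proof (cases "x = r")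
    case True
    have "d * poly ?W r = g' r - poly (pderiv p) r - c * poly (pderiv ?W) r"
      using W by (simp add: d_def)
    then show ?thesis
      by (simp add: pderiv_p True del: mult_pCons_left)
  next
    case False
    then have "poly ?W x = 0" "poly (pderiv ?W) x = 0"
      using that insert
      by (auto simp: poly_hermite_weight_eq_0_iff pderiv_hermite_weight_double_node)
    then show ?thesis
      using that False p by (simp add: pderiv_p del: mult_pCons_left)
  qed
  ultimately show ?case by blast
qed

lemma higher_pderiv_eq_const:
  fixes p :: "real poly"
  assumes "\<forall>i>m. coeff p i = 0"
  shows "(pderiv ^^ m) p = [:fact m * coeff p m:]"
proof (rule poly_eqI)
  fix i
  show "coeff ((pderiv ^^ m) p) i = coeff [:fact m * coeff p m:] i"
    using assms by (cases i) (auto simp: coeff_higher_pderiv pochhammer_fact)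
qed

text \<open>The remainder formula \<open>f(x) - p(x) = f\<^sup>(\<^sup>k\<^sup>)(z) / k! * W(x)\<close> in the form of a bound. For fixed \<open>x\<close>
outside the nodes choose \<open>c\<close> so that \<open>E = f - p - c W\<close> also vanishes at \<open>x\<close>. Then \<open>E\<close> has
\<open>|S| + |R| + 1\<close> zeros, so \<open>E'\<close> has \<open>|S| + |R|\<close> zeros strictly between them and another \<open>|R|\<close> at the
double nodes: \<open>k\<close> zeros in all. Rolle's theorem applied \<open>k - 1\<close> more times yields a zero of the
\<open>k\<close>-th derivative of \<open>E\<close>, which equals \<open>f\<^sup>(\<^sup>k\<^sup>) - k! c\<close> because \<open>W\<close> is monic of degree \<open>k\<close>.\<close>

lemma hermite_error:
  fixes D :: "nat \<Rightarrow> real \<Rightarrow> real"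
  assumes chain: "derivative_chain a b k D"
    and k: "k = card S + 2 * card R" "k > 0"
    and SR: "finite S" "finite R" "S \<inter> R = {}" "S \<union> R \<subseteq> {a..b}"
    and p: "\<forall>i\<ge>k. coeff p i = 0" "\<forall>x\<in>S \<union> R. poly p x = D 0 x"
      "\<forall>x\<in>R. poly (pderiv p) x = D 1 x"
    and M: "\<And>x. x \<in> {a..b} \<Longrightarrow> \<bar>D k x\<bar> \<le> M"
    and x: "x \<in> {a..b}"
  shows "\<bar>D 0 x - poly p x\<bar> \<le> M / fact k * \<bar>poly (hermite_weight S R) x\<bar>"
proof (cases "x \<in> S \<union> R")
  case True
  then have "poly (hermite_weight S R) x = 0" "poly p x = D 0 x"
    using p SR by (simp_all add: poly_hermite_weight_eq_0_iff)
  then show ?thesis by simp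
next
  case False
  let ?W = "hermite_weight S R"
  have W: "poly ?W x \<noteq> 0" using False SR by (simp add: poly_hermite_weight_eq_0_iff)
  define c where "c = (D 0 x - poly p x) / poly ?W x"
  let ?q = "p + smult c ?W"
  define E where "E = (\<lambda>j y. D j y - poly ((pderiv ^^ j) ?q) y)"
  obtain m where m: "k = Suc m" using gr0_implies_Suc[OF k(2)] by blast
  have chainE: "derivative_chain a b (Suc m) E"
    unfolding E_def using derivative_chain_diff[OF chain derivative_chain_poly] m by simp
  have zero: "E 0 z = 0" if "z \<in> insert x (S \<union> R)" for z
  proof (cases "z = x")
    case True
    then show ?thesis using W by (simp add: E_def c_def)
  next
    case False
    then have "poly ?W z = 0" using that SR by (simp add: poly_hermite_weight_eq_0_iff)
    then show ?thesis using that False p by (simp add: E_def)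
  qed
  have double_zero: "E 1 z = 0" if "z \<in> R" for z
    using that p SR
    by (simp add: E_def pderiv_add pderiv_smult pderiv_hermite_weight_double_node)
  have der: "(E 0 has_real_derivative E 1 y) (at y within {a..b})" if "y \<in> {a..b}" for y
    using derivative_chainD[OF chainE _ that, of 0] by simp
  have Z: "finite (insert x (S \<union> R))" "insert x (S \<union> R) \<noteq> {}" "insert x (S \<union> R) \<subseteq> {a..b}"
    using SR x by auto
  obtain Y where Y: "finite Y" "Suc (card Y) = card (insert x (S \<union> R))"
      "Y \<inter> insert x (S \<union> R) = {}" "Y \<subseteq> {a<..<b}" "\<forall>y\<in>Y. E 1 y = 0"
    by (rule Rolle_finite[OF der Z zero]) blast
  then have "Y \<subseteq> {a..b}" by auto
  with SR have sub: "Y \<union> R \<subseteq> {a..b}" by blast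
  have "card (S \<union> R) = card S + card R" using SR by (simp add: card_Un_disjoint)
  then have "card Y = card S + card R" using Y(2) False SR by simp
  moreover have "card (Y \<union> R) = card Y + card R"
    using Y(1,3) SR by (intro card_Un_disjoint) auto
  ultimately have "card (Y \<union> R) = Suc m" using k m by simp
  then have "\<exists>z\<in>{a..b}. E (Suc m) z = 0"
    using Y(1,5) double_zero SR(2) sub
    by (intro Rolle_iterated[OF derivative_chain_shift[OF chainE], of "Y \<union> R"]) auto
  then obtain z where z: "z \<in> {a..b}" "E k z = 0" unfolding m by blast
  have "(pderiv ^^ k) ?q = [:fact k * coeff ?q k:]"
    using p(1) k by (intro higher_pderiv_eq_const) (auto simp: coeff_eq_0 degree_hermite_weight)
  also have "coeff ?q k = c"
    using p(1) lead_coeff_hermite_weight[of S R] by (simp add: degree_hermite_weight k)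
  finally have "D k z = fact k * c"
    using z(2) by (simp add: E_def)
  then have "\<bar>c\<bar> * fact k \<le> M" using M[OF z(1)] by (simp add: abs_mult mult.commute)
  then have "\<bar>c\<bar> \<le> M / fact k" by (simp add: field_simps)
  moreover have "\<bar>D 0 x - poly p x\<bar> = \<bar>c\<bar> * \<bar>poly ?W x\<bar>"
    using W by (simp add: c_def)
  ultimately show ?thesis by (metis mult_right_mono abs_ge_zero)
qed

section \<open>Gauss and Radau nodes from Rodrigues' formula\<close>

text \<open>Each differentiation lowers the multiplicity of a factor by at most one.\<close>

lemma higher_pderiv_power_dvd:
  fixes p q :: "real poly"
  assumes "q ^ (i + j) dvd p"
  shows "q ^ i dvd (pderiv ^^ j) p"
  using assms
proof (induction j arbitrary: p)
  case 0
  then show ?case by simp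
next
  case (Suc j)
  have "q ^ Suc (i + j) dvd p" using Suc.prems by (simp only: add_Suc_right)
  then obtain r where r: "p = q ^ Suc (i + j) * r" by (rule dvdE)
  have "pderiv p = q ^ (i + j) * (q * pderiv r + smult (of_nat (Suc (i + j))) (pderiv q * r))"
    unfolding r pderiv_mult pderiv_power_Suc by (simp add: algebra_simps)
  then have "q ^ (i + j) dvd pderiv p" by simp
  then show ?case using Suc.IH[of "pderiv p"] by (simp add: funpow_swap1)
qed

text \<open>By Rodrigues' formula the \<open>n\<close>-th derivative of \<open>(x - 1)\<^sup>n (x + 1)\<^sup>n\<^sup>+\<^sup>e\<close> is, up to a constant,
\<open>(x + 1)\<^sup>e\<close> times the Jacobi polynomial of degree \<open>n\<close> for the weight \<open>(x + 1)\<^sup>e\<close> on \<open>[-1, 1]\<close>; for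
\<open>e = 0\<close> this is the Legendre polynomial.\<close>

definition jacobi_kernel :: "nat \<Rightarrow> nat \<Rightarrow> real poly" where
  "jacobi_kernel m n = [:-1, 1:] ^ m * [:1, 1:] ^ n"

lemma degree_jacobi_kernel: "degree (jacobi_kernel m n) = m + n"
  by (simp add: jacobi_kernel_def degree_mult_eq degree_power_eq)

lemma lead_coeff_jacobi_kernel: "lead_coeff (jacobi_kernel m n) = 1"
  by (simp only: jacobi_kernel_def lead_coeff_mult lead_coeff_power) simp

lemma higher_pderiv_jacobi_kernel_ends:
  assumes "j < m" "j < n"
  shows "poly ((pderiv ^^ j) (jacobi_kernel m n)) 1 = 0"
    and "poly ((pderiv ^^ j) (jacobi_kernel m n)) (-1) = 0"
proof -
  have "[:-1, 1::real:] ^ (1 + j) dvd [:-1, 1:] ^ m" "[:1, 1::real:] ^ (1 + j) dvd [:1, 1:] ^ n"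
    using assms by (intro le_imp_power_dvd; simp)+
  then have "[:-1, 1:] ^ (1 + j) dvd jacobi_kernel m n" "[:1, 1:] ^ (1 + j) dvd jacobi_kernel m n"
    by (simp_all only: jacobi_kernel_def dvd_mult dvd_mult2)
  then have "[:-1, 1:] dvd (pderiv ^^ j) (jacobi_kernel m n)"
      "[:1, 1:] dvd (pderiv ^^ j) (jacobi_kernel m n)"
    using higher_pderiv_power_dvd[of _ 1 j] by fastforce+
  then show "poly ((pderiv ^^ j) (jacobi_kernel m n)) 1 = 0"
    "poly ((pderiv ^^ j) (jacobi_kernel m n)) (-1) = 0"
    by (simp_all add: poly_eq_0_iff_dvd)
qed

text \<open>As long as \<open>j < m\<close>, the \<open>j\<close>-th derivative still vanishes at both endpoints. Together with its
\<open>j\<close> interior zeros these give \<open>j + 2\<close> zeros, hence \<open>j + 1\<close> interior zeros of the next derivative.\<close>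

lemma higher_pderiv_jacobi_kernel_roots:
  assumes "m \<le> n" "j \<le> m"
  shows "\<exists>R. finite R \<and> card R = j \<and> R \<subseteq> {-1<..<1} \<and>
           (\<forall>r\<in>R. poly ((pderiv ^^ j) (jacobi_kernel m n)) r = 0)"
  using \<open>j \<le> m\<close>
proof (induction j)
  case 0
  then show ?case by (intro exI[of _ "{}"]) auto
next
  case (Suc j)
  let ?p = "(pderiv ^^ j) (jacobi_kernel m n)"
  obtain R where R: "finite R" "card R = j" "R \<subseteq> {-1<..<1}" "\<forall>r\<in>R. poly ?p r = 0"
    using Suc by auto
  let ?Z = "insert (-1) (insert 1 R)"
  have Z: "finite ?Z" "?Z \<noteq> {}" "?Z \<subseteq> {-1..1}" using R by auto
  have zero: "poly ?p z = 0" if "z \<in> ?Z" for z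
    using that R higher_pderiv_jacobi_kernel_ends[of j m n] Suc.prems \<open>m \<le> n\<close> by auto
  have der: "(poly ?p has_real_derivative poly (pderiv ?p) x) (at x within {-1..1})"
    if "x \<in> {-1..1}" for x
    by (rule has_field_derivative_at_within[OF poly_DERIV])
  obtain Y where Y: "finite Y" "Suc (card Y) = card ?Z" "Y \<subseteq> {-1<..<1}"
      "\<forall>y\<in>Y. poly (pderiv ?p) y = 0"
    by (rule Rolle_finite[OF der Z zero]) blast
  have "-1 \<notin> R" "1 \<notin> R" using R by auto
  then have "card ?Z = Suc (Suc j)" using R by simp
  then show ?case using Y by (intro exI[of _ Y]) simp
qed

text \<open>The simple nodes, of which there are \<open>e \<in> {0, 1}\<close>: none for the Gauss nodes, the left endpoint for
the Radau nodes.\<close>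

definition left_end :: "nat \<Rightarrow> real set" where
  "left_end e = (if e = 0 then {} else {-1})"

lemma finite_left_end [simp]: "finite (left_end e)"
  by (simp add: left_end_def)

lemma card_left_end: "e \<le> 1 \<Longrightarrow> card (left_end e) = e"
  by (auto simp: left_end_def)

text \<open>Both sides have degree \<open>n + e\<close> and the same leading coefficient, and they agree at \<open>n + e\<close> points:
the \<open>n\<close> interior zeros and, if \<open>e = 1\<close>, the point \<open>-1\<close>, where the exponent \<open>n + 1\<close> of the kernel
exceeds the number of differentiations by one.\<close>

lemma jacobi_factorization:
  assumes "e \<le> 1"
  obtains R where "finite R" "card R = n" "R \<subseteq> {-1<..<1}"
    "(pderiv ^^ n) (jacobi_kernel n (n + e)) =
       smult (fact (2 * n + e) / fact (n + e)) (node_poly (left_end e) * node_poly R)"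
proof -
  let ?U = "(pderiv ^^ n) (jacobi_kernel n (n + e))"
  let ?c = "fact (2 * n + e) / fact (n + e) :: real"
  obtain R where R: "finite R" "card R = n" "R \<subseteq> {-1<..<1}" "\<forall>r\<in>R. poly ?U r = 0"
    using higher_pderiv_jacobi_kernel_roots[of n "n + e" n] by auto
  let ?V = "node_poly (left_end e) * node_poly R"
  have disj: "left_end e \<inter> R = {}" using R by (auto simp: left_end_def)
  have left: "poly ?U z = 0" if "z \<in> left_end e" for z
  proof -
    from that have "e = 1" "z = -1" using assms by (auto simp: left_end_def split: if_splits)
    have "[:1, 1:] ^ (1 + n) dvd jacobi_kernel n (n + e)"
      by (simp add: jacobi_kernel_def \<open>e = 1\<close>)
    then have "[:1, 1:] dvd ?U" using higher_pderiv_power_dvd[of _ 1 n] by fastforce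
    then show ?thesis by (simp add: poly_eq_0_iff_dvd \<open>z = -1\<close>)
  qed
  have degV: "degree ?V = n + e"
    using R assms by (simp add: degree_mult_eq card_left_end)
  have "?U = smult ?c ?V"
  proof (rule poly_eqI_degree_lead_coeff)
    have "fact (n + e + n) = fact (n + e) * pochhammer (1 + of_nat (n + e) :: real) n"
      using pochhammer_product'[of "1 :: real" "n + e" n] by (simp only: pochhammer_fact)
    moreover have "n + e + n = 2 * n + e" by simp
    ultimately have "pochhammer (1 + of_nat (n + e)) n = ?c"
      by (simp only: nonzero_eq_divide_eq[OF fact_nonzero] mult.commute)
    moreover have "coeff (jacobi_kernel n (n + e)) (n + e + n) = 1"
      using lead_coeff_jacobi_kernel[of n "n + e"] by (simp add: degree_jacobi_kernel add.commute)
    ultimately have "coeff ?U (n + e) = ?c" by (simp add: coeff_higher_pderiv add.commute)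
    moreover have "coeff ?V (n + e) = 1"
      using degV lead_coeff_mult[of "node_poly (left_end e)" "node_poly R"]
      by (simp add: lead_coeff_node_poly del: degree_node_poly)
    ultimately show "coeff ?U (n + e) = coeff (smult ?c ?V) (n + e)" by simp
    show "n + e \<le> card (left_end e \<union> R)"
      using R assms disj by (simp add: card_Un_disjoint card_left_end)
    show "degree ?U \<le> n + e" by (simp add: degree_higher_pderiv degree_jacobi_kernel)
    show "degree (smult ?c ?V) \<le> n + e" using degV by simp
    show "poly ?U z = poly (smult ?c ?V) z" if "z \<in> left_end e \<union> R" for z
      using that R left by (auto simp: poly_node_poly_eq_0_iff)
  qed
  with R that show thesis by blast
qed

section \<open>The integral of the nodal polynomial\<close>

lemma integrable_poly: "poly p integrable_on {a..b :: real}"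
  by (intro integrable_continuous_interval continuous_intros)

lemma integral_poly_smult: "integral {a..b} (poly (smult c p)) = c * integral {a..b :: real} (poly p)"
  by (simp add: poly_smult[abs_def])

lemma integral_poly_add:
  "integral {a..b} (poly (p + q)) = integral {a..b :: real} (poly p) + integral {a..b} (poly q)"
  using integral_add[OF integrable_poly integrable_poly] by (simp add: poly_add[abs_def])

lemma integral_pderiv:
  "a \<le> b \<Longrightarrow> integral {a..b :: real} (poly (pderiv p)) = poly p b - poly p a"
  by (intro integral_unique fundamental_theorem_of_calculus)
    (auto simp flip: has_real_derivative_iff_has_vector_derivative
      intro: has_field_derivative_at_within[OF poly_DERIV])

lemma integral_poly_by_parts:
  fixes a b :: real
  assumes "a \<le> b" "poly p a = 0" "poly p b = 0"
  shows "integral {a..b} (poly (pderiv p * q)) = - integral {a..b} (poly (p * pderiv q))"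
proof -
  have "integral {a..b} (poly (pderiv (p * q))) = 0"
    using assms by (simp add: integral_pderiv)
  then show ?thesis
    by (simp add: pderiv_mult integral_poly_add mult.commute)
qed

lemma integral_poly_by_parts_iterated:
  fixes a b :: real
  assumes "a \<le> b" "\<forall>j<n. poly ((pderiv ^^ j) p) a = 0 \<and> poly ((pderiv ^^ j) p) b = 0"
  shows "integral {a..b} (poly ((pderiv ^^ n) p * q)) =
           (-1) ^ n * integral {a..b} (poly (p * (pderiv ^^ n) q))"
  using assms(2)
proof (induction n arbitrary: q)
  case 0
  then show ?case by simp
next
  case (Suc n)
  have "integral {a..b} (poly ((pderiv ^^ Suc n) p * q)) =
      - integral {a..b} (poly ((pderiv ^^ n) p * pderiv q))"
    using integral_poly_by_parts[OF \<open>a \<le> b\<close>, of "(pderiv ^^ n) p" q] Suc.prems by simp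
  also have "\<dots> = (-1) ^ Suc n * integral {a..b} (poly (p * (pderiv ^^ Suc n) q))"
    using Suc by (simp add: funpow_swap1 del: poly_mult)
  finally show ?case .
qed

text \<open>A Beta integral. Integrating the derivative of \<open>(x - 1)\<^sup>m\<^sup>+\<^sup>1 (x + 1)\<^sup>n\<^sup>+\<^sup>1\<close>, which vanishes at both
ends, trades one unit of \<open>m\<close> for one unit of \<open>n\<close> and so reduces everything to \<open>m = 0\<close>.\<close>

lemma integral_jacobi_kernel:
  "integral {-1..1} (poly (jacobi_kernel m n)) =
     (-1) ^ m * fact m * fact n * 2 ^ (m + n + 1) / fact (m + n + 1)"
proof (induction m arbitrary: n)
  case 0
  have "jacobi_kernel 0 n = pderiv (smult (1 / (real n + 1)) ([:1, 1:] ^ Suc n))"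
    by (simp add: jacobi_kernel_def pderiv_smult pderiv_power_Suc pderiv_pCons field_simps
        del: power_Suc)
  then show ?case by (simp add: integral_pderiv add.commute)
next
  case (Suc m)
  let ?I = "\<lambda>m n. integral {-1..1} (poly (jacobi_kernel m n))"
  have "pderiv (jacobi_kernel (Suc m) (Suc n)) =
      smult (real (Suc m)) (jacobi_kernel m (Suc n)) +
      smult (real (Suc n)) (jacobi_kernel (Suc m) n)"
    by (simp add: jacobi_kernel_def pderiv_mult pderiv_power_Suc pderiv_pCons algebra_simps
        del: power_Suc)
  moreover have "poly (jacobi_kernel (Suc m) (Suc n)) 1 = 0" "poly (jacobi_kernel (Suc m) (Suc n)) (-1) = 0"
    by (simp_all add: jacobi_kernel_def)
  ultimately have "real (Suc m) * ?I m (Suc n) + real (Suc n) * ?I (Suc m) n = 0"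
    using integral_pderiv[of "-1" 1 "jacobi_kernel (Suc m) (Suc n)"]
    by (simp add: integral_poly_add integral_poly_smult del: of_nat_Suc)
  then have "?I (Suc m) n = - (real (Suc m) / real (Suc n)) * ?I m (Suc n)"
    by (simp add: field_simps)
  also have "?I m (Suc n) = (-1) ^ m * fact m * fact (Suc n) * 2 ^ (m + Suc n + 1) / fact (m + Suc n + 1)"
    by (rule Suc.IH)
  finally show ?case by (simp add: field_simps del: of_nat_Suc)
qed

text \<open>Up to the factor from Rodrigues' formula, the integrand is an \<open>n\<close>-th derivative times the monic
polynomial \<open>node_poly R\<close> of degree \<open>n\<close>. Integration by parts moves all derivatives onto the latter,
where they leave the constant \<open>n!\<close>, and only the Beta integral of the kernel remains.\<close>

lemma integral_hermite_weight_jacobi: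
  fixes R :: "real set"
  assumes "finite R" "card R = n"
    and U: "(pderiv ^^ n) (jacobi_kernel n (n + e)) =
       smult (fact (2 * n + e) / fact (n + e)) (node_poly S * node_poly R)"
  shows "integral {-1..1} (poly (hermite_weight S R)) =
    2 ^ (2 * n + e + 1) * fact n ^ 2 * fact (n + e) ^ 2 / (fact (2 * n + e) * fact (2 * n + e + 1))"
proof -
  have exponent: "n + (n + e) = 2 * n + e" by simp
  let ?Q = "jacobi_kernel n (n + e)" and ?c = "fact (2 * n + e) / fact (n + e) :: real"
  have "?c * integral {-1..1} (poly (hermite_weight S R)) =
      integral {-1..1} (poly ((pderiv ^^ n) ?Q * node_poly R))"
    unfolding U integral_poly_smult[symmetric] hermite_weight_def by (simp add: power2_eq_square mult.assoc)
  also have "\<dots> = (-1) ^ n * integral {-1..1} (poly (?Q * (pderiv ^^ n) (node_poly R)))"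
    using higher_pderiv_jacobi_kernel_ends by (intro integral_poly_by_parts_iterated) auto
  also have "(pderiv ^^ n) (node_poly R) = [:fact n * coeff (node_poly R) n:]"
    using assms by (intro higher_pderiv_eq_const) (auto intro: coeff_eq_0)
  also have "coeff (node_poly R) n = 1"
    using lead_coeff_node_poly[of R] assms by simp
  also have "?Q * [:fact n * 1:] = smult (fact n) ?Q" by simp
  also have "integral {-1..1} (poly (smult (fact n) ?Q)) =
      (-1) ^ n * (fact n ^ 2 * fact (n + e) * 2 ^ (2 * n + e + 1) / fact (2 * n + e + 1))"
    unfolding integral_poly_smult integral_jacobi_kernel exponent
    by (simp only: power2_eq_square times_divide_eq_right mult.assoc mult.left_commute)
  also have "(-1) ^ n * ((-1) ^ n * z) = z" for z :: real
    by (cases "even n") auto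
  finally show ?thesis
    by (simp add: field_simps power2_eq_square del: fact_Suc)
qed

text \<open>The constant \<open>alpha k\<close> is twice the error constant \<open>1 / k! * integral of W\<close> for the Gauss
(\<open>e = 0\<close>) or Radau (\<open>e = 1\<close>) nodal polynomial \<open>W\<close>, whose integral was evaluated above.\<close>

lemma alpha_eq:
  assumes "e \<le> 1"
  shows "alpha (2 * n + e) = 2 / fact (2 * n + e) *
    (2 ^ (2 * n + e + 1) * fact n ^ 2 * fact (n + e) ^ 2 / (fact (2 * n + e) * fact (2 * n + e + 1)))"
proof -
  have pow: "(4 :: real) ^ (n + 1) = 2 * 2 ^ (2 * n + 1)"
    by (simp add: power_mult)
  from assms consider "e = 0" | "e = 1" by linarith
  then show ?thesis
  proof cases
    case 1
    have arith: "2 * P * A ^ 4 / (N * B ^ 3) = 2 / B * (P * A ^ 2 * A ^ 2 / (B * (N * B)))"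
      for P A N B :: real
      by (simp add: power2_eq_square power3_eq_cube power4_eq_xxxx ac_simps)
    have "alpha (2 * n) = 4 ^ (n + 1) * fact n ^ 4 / ((2 * real n + 1) * fact (2 * n) ^ 3)"
      by (simp add: alpha_def)
    moreover have "fact (2 * n + 1) = (2 * real n + 1) * fact (2 * n)" by simp
    ultimately show ?thesis
      unfolding 1 add_0_right pow by (simp only: arith)
  next
    case 2
    have arith: "2 * P * N * A ^ 4 / C ^ 3 = 2 / C * (2 * P * A ^ 2 * (N * A) ^ 2 / (C * (2 * N * C)))"
      if "N \<noteq> 0" for P A N C :: real
      using that by (simp add: power2_eq_square power3_eq_cube power4_eq_xxxx ac_simps)
    have "alpha (2 * n + 1) = 4 ^ (n + 1) * (real n + 1) * fact n ^ 4 / fact (2 * n + 1) ^ 3"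
      by (simp add: alpha_def del: fact_Suc)
    moreover have "fact (2 * n + 1 + 1) = 2 * (real n + 1) * fact (2 * n + 1)"
      "fact (n + 1) = (real n + 1) * fact n" "(2 :: real) ^ (2 * n + 1 + 1) = 2 * 2 ^ (2 * n + 1)"
      by (simp_all add: algebra_simps)
    moreover have "real n + 1 \<noteq> 0" by linarith
    ultimately show ?thesis
      unfolding 2 pow by (simp only: arith[OF \<open>real n + 1 \<noteq> 0\<close>])
  qed
qed

section \<open>Regularity relative to the interval\<close>

lemma nth_derivative_0: "nth_derivative 0 f = f"
  by (simp add: nth_derivative_def)

lemma nth_derivative_Suc:
  "nth_derivative (Suc j) f x = vector_derivative (nth_derivative j f) (at x within {-1..1})"
  by (simp add: nth_derivative_def)

lemma derivative_chain_nth_derivative: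
  "f \<in> C_k k \<Longrightarrow> derivative_chain (-1) 1 k (\<lambda>j. nth_derivative j f)"
  by (auto simp: C_k_def derivative_chain_def nth_derivative_Suc differentiable_on_def
      has_real_derivative_iff_has_vector_derivative simp flip: vector_derivative_works)

lemma nth_derivative_poly:
  "x \<in> {-1..1} \<Longrightarrow> nth_derivative j (poly p) x = poly ((pderiv ^^ j) p) x"
proof (induction j arbitrary: x)
  case 0
  then show ?case by (simp add: nth_derivative_0)
next
  case (Suc j)
  have "(poly ((pderiv ^^ j) p) has_vector_derivative poly ((pderiv ^^ Suc j) p) x)
      (at x within {-1..1})"
    by (auto simp flip: has_real_derivative_iff_has_vector_derivative
        intro: has_field_derivative_at_within[OF poly_DERIV])
  then have "(nth_derivative j (poly p) has_vector_derivative poly ((pderiv ^^ Suc j) p) x)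
      (at x within {-1..1})"
    by (rule has_vector_derivative_transform[OF Suc.prems Suc.IH, rotated])
  then show ?case
    unfolding nth_derivative_Suc using Suc.prems
    by (intro vector_derivative_within_closed_interval) auto
qed

lemma poly_in_C_k: "poly p \<in> C_k k"
proof -
  have "nth_derivative j (poly p) differentiable_on {-1..1}" for j
    unfolding differentiable_on_def
  proof
    fix x :: real assume x: "x \<in> {-1..1}"
    have "(poly ((pderiv ^^ j) p) has_derivative (\<lambda>h. poly (pderiv ((pderiv ^^ j) p)) x * h))
        (at x within {-1..1})"
      using has_field_derivative_at_within[OF poly_DERIV] by (simp add: has_field_derivative_def)
    then show "nth_derivative j (poly p) differentiable (at x within {-1..1})"
      by (intro differentiableI has_derivative_transform[OF x nth_derivative_poly])
  qed
  then show ?thesis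
    by (auto simp: C_k_def intro: differentiable_imp_continuous_on)
qed

lemma abs_le_sup_norm:
  assumes "continuous_on {-1..1} g" "x \<in> {-1..1}"
  shows "\<bar>g x\<bar> \<le> sup_norm g"
proof -
  have "compact ((\<lambda>x. \<bar>g x\<bar>) ` {-1..1})"
    using assms(1) by (intro compact_continuous_image continuous_intros) auto
  then have "bdd_above ((\<lambda>x. \<bar>g x\<bar>) ` {-1..1})"
    by (intro bounded_imp_bdd_above compact_imp_bounded)
  then show ?thesis
    unfolding sup_norm_def using assms(2) by (intro cSUP_upper)
qed

section \<open>The error estimate\<close>

text \<open>Interior nodes are double and the only simple node is an end of the interval, so the nodal
polynomial does not change sign. The bound on the interpolation error is therefore itself a
polynomial, with no absolute value.\<close>

lemma poly_hermite_weight_nonneg: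
  assumes "e \<le> 1" "x \<in> {-1..1}"
  shows "poly (hermite_weight (left_end e) R) x \<ge> 0"
  using assms by (auto simp: hermite_weight_def left_end_def node_poly_def)

theorem theorem21:
  fixes k :: nat
    and X :: "(real \<Rightarrow> real) set"
    and T :: "(real \<Rightarrow> real) \<Rightarrow> real"
    and f :: "real \<Rightarrow> real"
  assumes "k \<ge> 2"
    and "function_subspace X"
    and "C_k k \<subseteq> X"
    and "{g. m_convex (k - 1) g} \<subseteq> X"
    and "linear_functional_on X T"
    and "positive_functional_on X T"
    and "exact_on_polys k T"
    and "f \<in> C_k k"
  shows "\<bar>integral {-1..1} f - T f\<bar> \<le> alpha k * sup_norm (nth_derivative k f)"
proof -
  define n e where "n = k div 2" and "e = k mod 2"
  have k: "k = 2 * n + e" and e: "e \<le> 1" unfolding n_def e_def by auto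
  let ?S = "left_end e" and ?M = "sup_norm (nth_derivative k f)"
  obtain R where R: "finite R" "card R = n" "R \<subseteq> {-1<..<1}"
    and U: "(pderiv ^^ n) (jacobi_kernel n (n + e)) =
       smult (fact (2 * n + e) / fact (n + e)) (node_poly ?S * node_poly R)"
    using jacobi_factorization[OF e] by blast
  let ?W = "hermite_weight ?S R"
  have SR: "finite ?S" "finite R" "?S \<inter> R = {}" "?S \<union> R \<subseteq> {-1..1}"
    using R by (auto simp: left_end_def)
  have card: "k = card ?S + 2 * card R" using R k e by (simp add: card_left_end)
  obtain p where p: "\<forall>i\<ge>k. coeff p i = 0"
      "\<forall>x\<in>?S \<union> R. poly p x = nth_derivative 0 f x"
      "\<forall>x\<in>R. poly (pderiv p) x = nth_derivative 1 f x"
    using hermite_interpolation[OF SR(2,1,3)] unfolding card by metis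
  define c where "c = ?M / fact k"
  let ?l = "p + smult (- c) ?W" and ?u = "p + smult c ?W"
  have cont: "continuous_on {-1..1} (nth_derivative k f)"
    using \<open>f \<in> C_k k\<close> by (simp add: C_k_def)
  have error: "\<bar>f x - poly p x\<bar> \<le> c * poly ?W x" if "x \<in> {-1..1}" for x
    using hermite_error[OF derivative_chain_nth_derivative[OF \<open>f \<in> C_k k\<close>] card _ SR p
        abs_le_sup_norm[OF cont] that] poly_hermite_weight_nonneg[OF e that] \<open>k \<ge> 2\<close>
    by (simp add: nth_derivative_0 c_def)
  have sandwich: "poly ?l x \<le> f x" "f x \<le> poly ?u x" if "x \<in> {-1..1}" for x
    using error[OF that] by auto
  have exact: "T (poly (p + smult d ?W)) = integral {-1..1} (poly (p + smult d ?W))" for d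
  proof -
    have "degree (p + smult d ?W) \<le> k"
      using p(1) card by (intro degree_le) (auto simp: coeff_eq_0 degree_hermite_weight)
    then show ?thesis using \<open>exact_on_polys k T\<close> unfolding exact_on_polys_def by blast
  qed
  have inX: "f \<in> X" "poly q \<in> X" for q
    using assms poly_in_C_k by auto
  have "T (poly ?l) \<le> T f" "T f \<le> T (poly ?u)"
    using \<open>positive_functional_on X T\<close> inX sandwich unfolding positive_functional_on_def by blast+
  moreover have "f integrable_on {-1..1}"
    using \<open>f \<in> C_k k\<close> \<open>k \<ge> 2\<close> nth_derivative_0[of f]
    by (intro integrable_continuous_interval differentiable_imp_continuous_on)
      (force simp: C_k_def)
  then have "integral {-1..1} (poly ?l) \<le> integral {-1..1} f"
      "integral {-1..1} f \<le> integral {-1..1} (poly ?u)"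
    using sandwich by (auto intro!: integral_le integrable_poly)
  ultimately have "\<bar>integral {-1..1} f - T f\<bar>
      \<le> integral {-1..1} (poly ?u) - integral {-1..1} (poly ?l)"
    unfolding exact by linarith
  also have "\<dots> = 2 * c * integral {-1..1} (poly ?W)"
    unfolding integral_poly_add integral_poly_smult by simp
  also have "\<dots> = alpha k * ?M"
    unfolding integral_hermite_weight_jacobi[OF R(1,2) U] k alpha_eq[OF e] c_def by simp
  finally show ?thesis .
qed

end
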